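(* Let $T$ be a crystallographic tiling of $\mathbb{E}^n$. Then the hull $\Omega_T$ of $T$ is homeomorphic to the quotient topological space $\mathrm{Isom}(\mathbb{E}^n)/\mathrm{Aut}(T)$, by a homeomorphism that is equivariant under the natural actions of $\mathrm{Isom}(\mathbb{E}^n)$ (on $\Omega_T$ by $(\phi, S)\mapsto \phi(S)$, on the space of left cosets by left multiplication).
   Context: $\mathbb{E}^n$ is $n$-dimensional Euclidean space, $\mathrm{Isom}(\mathbb{E}^n)$ its group of isometries, $B_r(x)$ the closed ball of radius $r$ around $x$. Fix an origin $O\in\mathbb{E}^n$. Each isometry is uniquely $\tau\alpha$ with $\tau$ a translation and $\alpha$ an orthogonal map fixing $O$; put $d_O(\tau\alpha,\sigma\beta)=\|\tau-\sigma\|_{\mathrm{Eucl}}+\|\alpha-\beta\|_{\mathrm{op}}$ (Euclidean norm of translation vectors, operator norm of linear maps with origin $O$). This metric gives the usual topology of $\mathrm{Isom}(\mathbb{E}^n)$. A convex polytope is the convex hull of finitely many points; a face of an $n$-dimensional convex polytope $P$ is the intersection of $P$ with a supporting hyperplane (the empty set is also admitted as a face). A tiling of $\mathbb{E}^n$ is a set of $n$-dimensional convex polytopes $T=\{t_i\}_{i\in I}$ (the tiles) with $\bigcup_i t_i=\mathbb{E}^n$ such that for all $i\neq j$ the intersection $t_i\cap t_j$ is a face of both. A tiling is simple if there are finitely many convex polytopes (prototiles) such that every tile is the image of one of them under an isometry. For $\phi\in\mathrm{Isom}(\mathbb{E}^n)$ put $\phi(T)=\{\phi(t_i)\}_{i\in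 I}$. For bounded $A\subset\mathbb{E}^n$, $[T]_A$ is the set of all tiles of $T$ intersecting $A$. Metric on the set of all simple tilings of $\mathbb{E}^n$: $R(T,T')$ is the supremum of all $r>0$ for which there exist $\phi,\psi\in\mathrm{Isom}(\mathbb{E}^n)$ with $d_O(\phi,\mathbf 1)<\frac1{2r}$, $d_O(\psi,\mathbf 1)<\frac1{2r}$ ($\mathbf 1$ the identity) and $[\phi(T)]_{B_r(O)}=[\psi(T')]_{B_r(O)}$; then $d_O(T,T')=\min\{\ln(3/2),\ln(1+1/R(T,T'))\}$ (with $\sup\emptyset=0$, $1/0=\infty$, $1/\infty=0$). The induced topology does not depend on $O$. The hull $\Omega_T$ of a simple tiling $T$ is the closure of the orbit $\{\phi(T):\phi\in\mathrm{Isom}(\mathbb{E}^n)\}$ in the space of all simple tilings. A crystallographic group is a discrete subgroup $\Gamma\subset\mathrm{Isom}(\mathbb{E}^n)$ such that $\mathrm{Isom}(\mathbb{E}^n)/\Gamma$ is compact. $\mathrm{Aut}(T)=\{\phi\in\mathrm{Isom}(\mathbb{E}^n):\phi(T)=T\}$. A simple tiling $T$ is crystallographic if $\mathrm{Aut}(T)$ is a crystallographic group. *)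

theory Defs
  imports "HOL-Analysis.Analysis" "HOL-Algebra.Left_Coset"
begin

definition quotient_topology :: "'a topology \<Rightarrow> ('a \<Rightarrow> 'b) \<Rightarrow> 'b topology" where
  "quotient_topology X f =
     topology (\<lambda>U. U \<subseteq> f ` topspace X \<and> openin X {x \<in> topspace X. f x \<in> U})"

lemma openin_quotient_topology:
  "openin (quotient_topology X f) U \<longleftrightarrow>
     U \<subseteq> f ` topspace X \<and> openin X {x \<in> topspace X. f x \<in> U}"
proof -
  have 1: "openin X {x \<in> topspace X. f x \<in> S \<inter> V}"
    if "openin X {x \<in> topspace X. f x \<in> S}" "openin X {x \<in> topspace X. f x \<in> V}" for S V
  proof -
    have "{x \<in> topspace X. f x \<in> S \<inter> V} =
        {x \<in> topspace X. f x \<in> S} \<inter> {x \<in> topspace X. f x \<in> V}" by auto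
    with that show ?thesis by auto
  qed
  have 2: "openin X {x \<in> topspace X. f x \<in> \<Union>K}"
    if "\<forall>S\<in>K. openin X {x \<in> topspace X. f x \<in> S}" for K
  proof -
    have "{x \<in> topspace X. f x \<in> \<Union>K} = (\<Union>S\<in>K. {x \<in> topspace X. f x \<in> S})" by auto
    with that show ?thesis by auto
  qed
  have "istopology (\<lambda>U. U \<subseteq> f ` topspace X \<and> openin X {x \<in> topspace X. f x \<in> U})"
    unfolding istopology_def using 1 2 by (intro conjI allI impI; blast)
  then show ?thesis
    by (simp add: quotient_topology_def topology_inverse')
qed

lemma quotient_map_quotient_topology: "quotient_map X (quotient_topology X f) f"
proof -
  have "topspace (quotient_topology X f) = f ` topspace X"
  proof
    show "topspace (quotient_topology X f) \<subseteq> f ` topspace X"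
      using openin_topspace[of "quotient_topology X f"] unfolding openin_quotient_topology by blast
    have "{x \<in> topspace X. f x \<in> f ` topspace X} = topspace X" by auto
    then have "openin (quotient_topology X f) (f ` topspace X)"
      by (simp add: openin_quotient_topology)
    then show "f ` topspace X \<subseteq> topspace (quotient_topology X f)"
      by (rule openin_subset)
  qed
  then show ?thesis
    by (auto simp: quotient_map_def openin_quotient_topology)
qed


section \<open>The isometry group of Euclidean space\<close>

definition isom_group :: "('a::euclidean_space \<Rightarrow> 'a) monoid" where
  "isom_group =
     \<lparr>carrier = {\<phi>. surj \<phi> \<and> (\<forall>x y. dist (\<phi> x) (\<phi> y) = dist x y)}, mult = (\<circ>), one = id\<rparr>"

abbreviation Isom :: "('a::euclidean_space \<Rightarrow> 'a) set" where
  "Isom \<equiv> carrier isom_group"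

lemma Isom_iff: "\<phi> \<in> Isom \<longleftrightarrow> surj \<phi> \<and> (\<forall>x y. dist (\<phi> x) (\<phi> y) = dist x y)"
  by (simp add: isom_group_def)

lemma group_isom_group: "group (isom_group :: ('a::euclidean_space \<Rightarrow> 'a) monoid)"
proof (rule groupI)
  fix f :: "'a \<Rightarrow> 'a" assume f: "f \<in> carrier isom_group"
  have inj: "inj f"
    using f by (metis Isom_iff dist_eq_0_iff injI)
  have "inv_into UNIV f \<in> carrier isom_group"
    unfolding Isom_iff
  proof (intro conjI allI)
    show "surj (inv_into UNIV f)" using inj by (rule inj_imp_surj_inv)
    show "dist (inv_into UNIV f x) (inv_into UNIV f y) = dist x y" for x y
      using f by (metis Isom_iff surj_f_inv_f)
  qed
  then show "\<exists>g\<in>carrier isom_group. g \<otimes>\<^bsub>isom_group\<^esub> f = \<one>\<^bsub>isom_group\<^esub>"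
    using inj by (intro bexI) (auto simp: isom_group_def)
next
  fix f g :: "'a \<Rightarrow> 'a" assume "f \<in> carrier isom_group" "g \<in> carrier isom_group"
  then show "f \<otimes>\<^bsub>isom_group\<^esub> g \<in> carrier isom_group"
    using comp_surj[of g f] by (simp add: isom_group_def)
qed (simp_all add: isom_group_def comp_assoc)

text \<open>
  The factors of the decomposition of an isometry into an orthogonal map fixing \<open>ori\<close>, here
  read as a linear map of the vectors based at \<open>ori\<close>, followed by a translation.
\<close>

definition transl_part :: "'a::euclidean_space \<Rightarrow> ('a \<Rightarrow> 'a) \<Rightarrow> 'a" where
  "transl_part ori \<phi> = \<phi> ori - ori"

definition orth_part :: "'a::euclidean_space \<Rightarrow> ('a \<Rightarrow> 'a) \<Rightarrow> ('a \<Rightarrow> 'a)" where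
  "orth_part ori \<phi> = (\<lambda>v. \<phi> (ori + v) - \<phi> ori)"

lemma isom_decomposition:
  assumes "\<phi> \<in> Isom"
  shows "orthogonal_transformation (orth_part ori \<phi>)"
    and "\<phi> x = transl_part ori \<phi> + (ori + orth_part ori \<phi> (x - ori))"
proof -
  show "orthogonal_transformation (orth_part ori \<phi>)"
    using assms unfolding orthogonal_transformation_isometry
    by (simp add: orth_part_def Isom_iff dist_norm)
qed (simp add: transl_part_def orth_part_def)

lemma bounded_linear_orth_part: "\<phi> \<in> Isom \<Longrightarrow> bounded_linear (orth_part ori \<phi>)"
  by (simp add: isom_decomposition(1) linear_linear orthogonal_transformation_linear)

text \<open>The norm of the type of bounded linear maps is the operator norm.\<close>

definition isom_dist :: "'a::euclidean_space \<Rightarrow> ('a \<Rightarrow> 'a) \<Rightarrow> ('a \<Rightarrow> 'a) \<Rightarrow> real" where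
  "isom_dist ori \<phi> \<psi> =
     norm (transl_part ori \<phi> - transl_part ori \<psi>) +
     norm (Blinfun (orth_part ori \<phi>) - Blinfun (orth_part ori \<psi>))"

lemma isom_dist_onorm:
  assumes "\<phi> \<in> Isom" "\<psi> \<in> Isom"
  shows "isom_dist ori \<phi> \<psi> =
     norm (transl_part ori \<phi> - transl_part ori \<psi>) +
     onorm (\<lambda>v. orth_part ori \<phi> v - orth_part ori \<psi> v)"
  using assms
  by (simp add: isom_dist_def norm_blinfun.rep_eq minus_blinfun.rep_eq
      bounded_linear_Blinfun_apply bounded_linear_orth_part)

lemma Metric_space_isom_dist: "Metric_space Isom (isom_dist ori)"
proof
  show "isom_dist ori \<phi> \<psi> = 0 \<longleftrightarrow> \<phi> = \<psi>" if "\<phi> \<in> Isom" "\<psi> \<in> Isom" for \<phi> \<psi>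
  proof
    assume "isom_dist ori \<phi> \<psi> = 0"
    then have "norm (transl_part ori \<phi> - transl_part ori \<psi>) = 0"
      and "norm (Blinfun (orth_part ori \<phi>) - Blinfun (orth_part ori \<psi>)) = 0"
      unfolding isom_dist_def by (smt (verit) norm_ge_zero)+
    then have t: "transl_part ori \<phi> = transl_part ori \<psi>"
      and b: "Blinfun (orth_part ori \<phi>) = Blinfun (orth_part ori \<psi>)"
      by (simp_all only: norm_eq_zero right_minus_eq)
    have "orth_part ori \<phi> = blinfun_apply (Blinfun (orth_part ori \<phi>))"
      by (rule bounded_linear_Blinfun_apply[symmetric, OF bounded_linear_orth_part[OF that(1)]])
    also have "\<dots> = orth_part ori \<psi>"
      unfolding b by (rule bounded_linear_Blinfun_apply[OF bounded_linear_orth_part[OF that(2)]])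
    finally have "orth_part ori \<phi> = orth_part ori \<psi>" .
    with t have "\<phi> x = \<psi> x" for x
      using isom_decomposition(2)[OF that(1), of x ori] isom_decomposition(2)[OF that(2), of x ori]
      by simp
    then show "\<phi> = \<psi>" by (rule ext)
  qed (simp add: isom_dist_def)
  show "isom_dist ori \<phi> \<rho> \<le> isom_dist ori \<phi> \<psi> + isom_dist ori \<psi> \<rho>" for \<phi> \<psi> \<rho>
    unfolding isom_dist_def dist_norm[symmetric]
    using dist_triangle[of "transl_part ori \<phi>" "transl_part ori \<rho>" "transl_part ori \<psi>"]
      dist_triangle[of "Blinfun (orth_part ori \<phi>)" "Blinfun (orth_part ori \<rho>)"
        "Blinfun (orth_part ori \<psi>)"]
    by linarith
qed (simp_all add: isom_dist_def norm_minus_commute)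

definition isom_topology :: "'a::euclidean_space \<Rightarrow> ('a \<Rightarrow> 'a) topology" where
  "isom_topology ori = Metric_space.mtopology Isom (isom_dist ori)"

text \<open>The space of left cosets of \<open>\<Gamma>\<close> in the isometry group.\<close>

definition coset_space ::
    "'a::euclidean_space \<Rightarrow> ('a \<Rightarrow> 'a) set \<Rightarrow> ('a \<Rightarrow> 'a) set topology" where
  "coset_space ori \<Gamma> = quotient_topology (isom_topology ori) (\<lambda>\<phi>. \<phi> <#\<^bsub>isom_group\<^esub> \<Gamma>)"

lemma topspace_coset_space: "topspace (coset_space ori \<Gamma>) = lcosets\<^bsub>isom_group\<^esub> \<Gamma>"
proof -
  interpret Metric_space Isom "isom_dist ori" by (rule Metric_space_isom_dist)
  have "topspace (isom_topology ori) = Isom"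
    by (simp add: isom_topology_def)
  moreover have "(\<lambda>\<phi>. \<phi> <#\<^bsub>isom_group\<^esub> \<Gamma>) ` topspace (isom_topology ori) =
      topspace (coset_space ori \<Gamma>)"
    unfolding coset_space_def
    by (rule quotient_imp_surjective_map) (rule quotient_map_quotient_topology)
  ultimately show ?thesis
    by (simp add: LCOSETS_def UNION_singleton_eq_range)
qed

definition crystallographic_group :: "'a::euclidean_space \<Rightarrow> ('a \<Rightarrow> 'a) set \<Rightarrow> bool" where
  "crystallographic_group ori \<Gamma> \<longleftrightarrow>
     subgroup \<Gamma> isom_group \<and>
     subtopology (isom_topology ori) \<Gamma> = discrete_topology \<Gamma> \<and>
     compact_space (coset_space ori \<Gamma>)"


section \<open>Tilings\<close>

text \<open>
  Unlike \<open>face_of\<close> and \<open>exposed_face_of\<close>, this does not count a polytope among its own faces: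
  the hyperplane has to be a genuine one (\<open>a \<noteq> 0\<close>), which suffices for full-dimensional \<open>P\<close>.
\<close>

definition hyperplane_face :: "'a::euclidean_space set \<Rightarrow> 'a set \<Rightarrow> bool" where
  "hyperplane_face F P \<longleftrightarrow>
     F = {} \<or>
     (\<exists>a b. a \<noteq> 0 \<and> P \<subseteq> {x. a \<bullet> x \<le> b} \<and> P \<inter> {x. a \<bullet> x = b} \<noteq> {} \<and>
        F = P \<inter> {x. a \<bullet> x = b})"

definition tiling :: "'a::euclidean_space set set \<Rightarrow> bool" where
  "tiling T \<longleftrightarrow>
     (\<forall>t\<in>T. polytope t \<and> aff_dim t = int DIM('a)) \<and>
     \<Union>T = UNIV \<and>
     (\<forall>s\<in>T. \<forall>t\<in>T. s \<noteq> t \<longrightarrow> hyperplane_face (s \<inter> t) s \<and> hyperplane_face (s \<inter> t) t)"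

definition simple_tiling :: "'a::euclidean_space set set \<Rightarrow> bool" where
  "simple_tiling T \<longleftrightarrow>
     tiling T \<and>
     (\<exists>P. finite P \<and> (\<forall>p\<in>P. polytope p) \<and> (\<forall>t\<in>T. \<exists>p\<in>P. \<exists>\<phi>\<in>Isom. t = \<phi> ` p))"

definition tiling_image ::
    "('a::euclidean_space \<Rightarrow> 'a) \<Rightarrow> 'a set set \<Rightarrow> 'a set set" where
  "tiling_image \<phi> T = (\<lambda>t. \<phi> ` t) ` T"

definition tiles_meeting :: "'a::euclidean_space set set \<Rightarrow> 'a set \<Rightarrow> 'a set set" where
  "tiles_meeting T A = {t \<in> T. t \<inter> A \<noteq> {}}"

definition tiling_aut :: "'a::euclidean_space set set \<Rightarrow> ('a \<Rightarrow> 'a) set" where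
  "tiling_aut T = {\<phi> \<in> Isom. tiling_image \<phi> T = T}"

definition crystallographic_tiling ::
    "'a::euclidean_space \<Rightarrow> 'a set set \<Rightarrow> bool" where
  "crystallographic_tiling ori T \<longleftrightarrow>
     simple_tiling T \<and> crystallographic_group ori (tiling_aut T)"


section \<open>The space of simple tilings and the hull\<close>

text \<open>
  In the type of extended nonnegative reals \<open>Sup {} = 0\<close>, \<open>inverse 0 = \<infinity>\<close> and \<open>inverse \<infinity> = 0\<close>.
\<close>

definition agreement_radius ::
    "'a::euclidean_space \<Rightarrow> 'a set set \<Rightarrow> 'a set set \<Rightarrow> ennreal" where
  "agreement_radius ori T T' =
     Sup {ennreal r | r. 0 < r \<and>
       (\<exists>\<phi>\<in>Isom. \<exists>\<psi>\<in>Isom.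
          isom_dist ori \<phi> id < 1 / (2 * r) \<and> isom_dist ori \<psi> id < 1 / (2 * r) \<and>
          tiles_meeting (tiling_image \<phi> T) (cball ori r) =
          tiles_meeting (tiling_image \<psi> T') (cball ori r))}"

text \<open>If \<open>agreement_radius\<close> is \<open>0\<close>, then \<open>ln (1 + 1 / 0) = \<infinity>\<close> and the minimum is \<open>ln (3 / 2)\<close>.\<close>

definition tiling_dist ::
    "'a::euclidean_space \<Rightarrow> 'a set set \<Rightarrow> 'a set set \<Rightarrow> real" where
  "tiling_dist ori T T' =
     (let R = agreement_radius ori T T' in
      if R = 0 then ln (3 / 2) else min (ln (3 / 2)) (ln (1 + enn2real (inverse R))))"

text \<open>
  \<open>tiling_dist ori\<close> is a metric on the set of simple tilings; the following definition only
  refers to its open balls, so it makes sense without a proof of that.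
\<close>

definition tiling_topology :: "'a::euclidean_space \<Rightarrow> 'a set set topology" where
  "tiling_topology ori = Metric_space.mtopology {T. simple_tiling T} (tiling_dist ori)"

definition tiling_hull :: "'a::euclidean_space \<Rightarrow> 'a set set \<Rightarrow> 'a set set set" where
  "tiling_hull ori T =
     Abstract_Topology.closure_of (tiling_topology ori) {tiling_image \<phi> T | \<phi>. \<phi> \<in> Isom}"

definition hull_space :: "'a::euclidean_space \<Rightarrow> 'a set set \<Rightarrow> 'a set set topology" where
  "hull_space ori T = subtopology (tiling_topology ori) (tiling_hull ori T)"

end

theory Submission
  imports Defs
begin

text \<open>
  The orbit map \<open>\<phi> \<mapsto> \<phi>(T)\<close> is continuous from the isometry group to the space of simple
  tilings (\<open>continuous_map_orbit\<close>), and two isometries have the same value exactly when they lie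
  in the same left coset of \<open>Aut(T)\<close>. It therefore induces a continuous injection of the coset
  space onto the orbit of \<open>T\<close>. The coset space is compact because \<open>T\<close> is crystallographic, so
  the orbit is compact as well. Once the space of tilings is known to be Hausdorff, the orbit is
  closed, hence equal to the hull, and a continuous bijection from a compact space to a Hausdorff
  space is a homeomorphism. The required map is its inverse; equivariance holds because the orbit
  map is equivariant.

  The substance lies in the Hausdorff property, that is, in the fact that \<open>tiling_dist\<close>
  really is a metric (\<open>Metric_space_tiling_dist\<close>).

  For the triangle inequality, suppose that \<open>\<phi>\<^sub>1 S\<close> and \<open>\<psi>\<^sub>1 S'\<close> agree on a ball of radius
  \<open>r\<^sub>1\<close>, and \<open>\<phi>\<^sub>2 S'\<close> and \<open>\<psi>\<^sub>2 S''\<close> on a ball of radius \<open>r\<^sub>2\<close>. Moving both agreements so that the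
  middle tiling becomes \<open>\<phi>\<^sub>2 \<psi>\<^sub>1 S'\<close> compares \<open>\<phi>\<^sub>2 \<phi>\<^sub>1 S\<close> with
  \<open>(\<phi>\<^sub>2 \<psi>\<^sub>1 \<phi>\<^sub>2\<^sup>-\<^sup>1) \<psi>\<^sub>2 S''\<close>. Conjugation by \<open>\<phi>\<^sub>2\<close> multiplies the distance of \<open>\<psi>\<^sub>1\<close> from
  the identity by at most \<open>1 + 1 / (2 r\<^sub>2)\<close>, and this error is absorbed by the term
  \<open>1 / (r\<^sub>1 r\<^sub>2)\<close> of \<open>(1 + 1 / r\<^sub>1) (1 + 1 / r\<^sub>2)\<close>, which is why the metric is built with
  \<open>ln (1 + 1 / R)\<close>.

  For definiteness, let \<open>t\<close> be a tile of \<open>S\<close> and suppose that isometries \<open>\<xi>\<close> arbitrarily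
  close to the identity carry \<open>t\<close> to tiles of \<open>S'\<close>. As different tiles of \<open>S'\<close> have no
  common interior points and \<open>t\<close> contains a ball, all such \<open>\<xi>\<close> sufficiently close to the
  identity carry \<open>t\<close> to one and the same tile of \<open>S'\<close>, which must be \<open>t\<close> because tiles are closed.
\<close>


section \<open>Isometries and their distance\<close>

lemma Isom_comp: "\<phi> \<in> Isom \<Longrightarrow> \<psi> \<in> Isom \<Longrightarrow> \<phi> \<circ> \<psi> \<in> Isom"
  unfolding Isom_iff using comp_surj[of \<psi> \<phi>] by simp

lemma Isom_id: "id \<in> Isom"
  by (simp add: Isom_iff)

lemma Isom_dist: "\<phi> \<in> Isom \<Longrightarrow> dist (\<phi> x) (\<phi> y) = dist x y"
  by (simp add: Isom_iff)

lemma Isom_inj: "\<phi> \<in> Isom \<Longrightarrow> inj \<phi>"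
  by (metis Isom_iff dist_eq_0_iff injI)

lemma Isom_surj: "\<phi> \<in> Isom \<Longrightarrow> surj \<phi>"
  by (simp add: Isom_iff)

lemma Isom_inv: "\<phi> \<in> Isom \<Longrightarrow> inv_into UNIV \<phi> \<in> Isom"
  by (metis (no_types, lifting) Isom_iff Isom_inj inj_imp_surj_inv surj_f_inv_f)

lemma Isom_inv_comp: "\<phi> \<in> Isom \<Longrightarrow> inv_into UNIV \<phi> \<circ> \<phi> = id" "\<phi> \<in> Isom \<Longrightarrow> \<phi> \<circ> inv_into UNIV \<phi> = id"
  by (simp_all add: Isom_inj Isom_surj flip: surj_iff)

lemma orth_part_diff:
  assumes "\<phi> \<in> Isom"
  shows "\<phi> x - \<phi> y = orth_part ori \<phi> (x - y)"
proof -
  have "linear (orth_part ori \<phi>)"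
    using assms isom_decomposition(1) orthogonal_transformation_linear by blast
  then have "orth_part ori \<phi> (x - y) = orth_part ori \<phi> (x - ori) - orth_part ori \<phi> (y - ori)"
    by (metis diff_diff_eq2 diff_add_cancel linear_diff)
  then show ?thesis
    using isom_decomposition(2)[OF assms, of x ori] isom_decomposition(2)[OF assms, of y ori]
    by simp
qed

lemma isom_dist_nonneg: "0 \<le> isom_dist ori \<phi> \<psi>"
  by (simp add: isom_dist_def)

lemma isom_dist_commute: "isom_dist ori \<phi> \<psi> = isom_dist ori \<psi> \<phi>"
  by (simp add: isom_dist_def norm_minus_commute)

lemma isom_dist_triangle: "isom_dist ori \<phi> \<rho> \<le> isom_dist ori \<phi> \<psi> + isom_dist ori \<psi> \<rho>"
  unfolding isom_dist_def dist_norm[symmetric]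
  using dist_triangle[of "transl_part ori \<phi>" "transl_part ori \<rho>" "transl_part ori \<psi>"]
    dist_triangle[of "Blinfun (orth_part ori \<phi>)" "Blinfun (orth_part ori \<rho>)"
      "Blinfun (orth_part ori \<psi>)"]
  by linarith

lemma isom_dist_left_mult:
  assumes "\<xi> \<in> Isom" "\<phi> \<in> Isom" "\<psi> \<in> Isom"
  shows "isom_dist ori (\<xi> \<circ> \<phi>) (\<xi> \<circ> \<psi>) = isom_dist ori \<phi> \<psi>"
proof -
  have iso: "norm (orth_part ori \<xi> v) = norm v" for v
    using isom_decomposition(1)[OF assms(1)] orthogonal_transformation by blast
  have lin: "linear (orth_part ori \<xi>)"
    using assms(1) isom_decomposition(1) orthogonal_transformation_linear by blast
  have "orth_part ori (\<xi> \<circ> \<phi>) v = orth_part ori \<xi> (orth_part ori \<phi> v)" if "\<phi> \<in> Isom" for \<phi> v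
    using orth_part_diff[OF assms(1)] by (simp add: orth_part_def)
  then have "norm (orth_part ori (\<xi> \<circ> \<phi>) v - orth_part ori (\<xi> \<circ> \<psi>) v) =
      norm (orth_part ori \<phi> v - orth_part ori \<psi> v)" for v
    using assms iso by (metis lin linear_diff)
  then have "onorm (\<lambda>v. orth_part ori (\<xi> \<circ> \<phi>) v - orth_part ori (\<xi> \<circ> \<psi>) v) =
      onorm (\<lambda>v. orth_part ori \<phi> v - orth_part ori \<psi> v)"
    by (simp add: onorm_def)
  moreover have "norm (transl_part ori (\<xi> \<circ> \<phi>) - transl_part ori (\<xi> \<circ> \<psi>)) =
      norm (transl_part ori \<phi> - transl_part ori \<psi>)"
    using Isom_dist[OF assms(1), of "\<phi> ori" "\<psi> ori"] by (simp add: transl_part_def dist_norm)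
  ultimately show ?thesis
    using assms by (simp add: isom_dist_onorm Isom_comp)
qed

text \<open>
  Precomposing with \<open>\<xi>\<close> leaves the operator norm of the difference of the linear parts alone, but
  the translation parts are then read off at the point \<open>\<xi> ori\<close>, where the difference of
  the linear parts contributes in proportion to the distance from the origin.
\<close>

lemma isom_dist_bounds:
  assumes "\<phi> \<in> Isom" "\<psi> \<in> Isom"
  shows isom_dist_right_mult_le:
      "\<xi> \<in> Isom \<Longrightarrow> isom_dist ori (\<phi> \<circ> \<xi>) (\<psi> \<circ> \<xi>) \<le> isom_dist ori \<phi> \<psi> * (1 + dist (\<xi> ori) ori)"
    and dist_le_isom_dist:
      "dist (\<phi> x) (\<psi> x) \<le> isom_dist ori \<phi> \<psi> * (1 + dist x ori)"
proof -
  define A where "A = (\<lambda>v. orth_part ori \<phi> v - orth_part ori \<psi> v)"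
  define a where "a = onorm A"
  define \<tau> where "\<tau> = norm (transl_part ori \<phi> - transl_part ori \<psi>)"
  have blA: "bounded_linear A"
    unfolding A_def using assms by (intro bounded_linear_sub bounded_linear_orth_part)
  have a: "norm (A v) \<le> a * norm v" for v
    unfolding a_def using blA by (rule onorm)
  have a0: "0 \<le> a" unfolding a_def using blA by (rule onorm_pos_le)
  have dist: "isom_dist ori \<phi> \<psi> = \<tau> + a"
    using assms by (simp add: isom_dist_onorm a_def A_def \<tau>_def)
  have point: "dist (\<phi> x) (\<psi> x) \<le> \<tau> + a * dist x ori" for x
  proof -
    have "\<phi> x - \<psi> x = (transl_part ori \<phi> - transl_part ori \<psi>) + A (x - ori)"
      using isom_decomposition(2)[OF assms(1), of x ori] isom_decomposition(2)[OF assms(2), of x ori]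
      by (simp add: A_def)
    then have "norm (\<phi> x - \<psi> x) \<le> \<tau> + norm (A (x - ori))"
      unfolding \<tau>_def by (metis norm_triangle_ineq)
    with a[of "x - ori"] show ?thesis by (simp add: dist_norm)
  qed
  have expand: "\<tau> + a * d + a \<le> (\<tau> + a) * (1 + d)" if "0 \<le> d" for d
    using that mult_nonneg_nonneg[of \<tau> d] by (simp add: \<tau>_def algebra_simps)
  show "dist (\<phi> x) (\<psi> x) \<le> isom_dist ori \<phi> \<psi> * (1 + dist x ori)"
    using point[of x] expand[of "dist x ori"] a0 dist by simp
  assume \<xi>: "\<xi> \<in> Isom"
  have "onorm (\<lambda>v. orth_part ori (\<phi> \<circ> \<xi>) v - orth_part ori (\<psi> \<circ> \<xi>) v) \<le> a"
  proof (rule onorm_bound[OF a0])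
    fix v
    have "orth_part ori (\<phi> \<circ> \<xi>) v - orth_part ori (\<psi> \<circ> \<xi>) v = A (orth_part ori \<xi> v)"
      using orth_part_diff[OF assms(1)] orth_part_diff[OF assms(2)]
      by (simp add: A_def orth_part_def[of ori "\<phi> \<circ> \<xi>"] orth_part_def[of ori "\<psi> \<circ> \<xi>"]
          orth_part_def[of ori \<xi>])
    moreover have "norm (orth_part ori \<xi> v) = norm v"
      using isom_decomposition(1)[OF \<xi>] orthogonal_transformation by blast
    ultimately show
      "norm (orth_part ori (\<phi> \<circ> \<xi>) v - orth_part ori (\<psi> \<circ> \<xi>) v) \<le> a * norm v"
      using a by metis
  qed
  moreover have "norm (transl_part ori (\<phi> \<circ> \<xi>) - transl_part ori (\<psi> \<circ> \<xi>)) \<le> \<tau> + a * dist (\<xi> ori) ori"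
    using point[of "\<xi> ori"] by (simp add: transl_part_def dist_norm)
  ultimately have "isom_dist ori (\<phi> \<circ> \<xi>) (\<psi> \<circ> \<xi>) \<le> \<tau> + a * dist (\<xi> ori) ori + a"
    using assms \<xi> by (simp add: isom_dist_onorm Isom_comp)
  also have "\<dots> \<le> isom_dist ori \<phi> \<psi> * (1 + dist (\<xi> ori) ori)"
    unfolding dist by (rule expand) simp
  finally show "isom_dist ori (\<phi> \<circ> \<xi>) (\<psi> \<circ> \<xi>) \<le> isom_dist ori \<phi> \<psi> * (1 + dist (\<xi> ori) ori)" .
qed

lemma dist_ori_le_isom_dist:
  assumes "\<phi> \<in> Isom"
  shows "dist (\<phi> ori) ori \<le> isom_dist ori \<phi> id"
  using dist_le_isom_dist[OF assms Isom_id, of ori ori] by simp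

lemma isom_dist_comp_id_le:
  assumes "\<phi> \<in> Isom" "\<psi> \<in> Isom"
  shows "isom_dist ori (\<phi> \<circ> \<psi>) id \<le> isom_dist ori \<phi> id + isom_dist ori \<psi> id"
  using isom_dist_triangle[of ori "\<phi> \<circ> \<psi>" id \<phi>] isom_dist_left_mult[OF assms Isom_id, of ori]
  by simp

lemma isom_dist_inv_comp_id:
  assumes "\<phi> \<in> Isom" "\<psi> \<in> Isom"
  shows "isom_dist ori (inv_into UNIV \<phi> \<circ> \<psi>) id = isom_dist ori \<psi> \<phi>"
  using isom_dist_left_mult[OF Isom_inv[OF assms(1)] assms(2) assms(1), of ori] assms
  by (simp add: Isom_inv_comp)

lemma isom_dist_comp_inv_id_le:
  assumes "\<phi> \<in> Isom" "\<psi> \<in> Isom"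
  shows "isom_dist ori (\<psi> \<circ> inv_into UNIV \<phi>) id \<le> isom_dist ori \<psi> \<phi> * (1 + dist (\<phi> ori) ori)"
proof -
  have "dist (inv_into UNIV \<phi> ori) ori = dist (\<phi> ori) ori"
    using assms by (metis Isom_dist Isom_surj dist_commute surj_f_inv_f)
  then show ?thesis
    using isom_dist_right_mult_le[OF assms(2,1) Isom_inv[OF assms(1)], of ori] assms
    by (simp add: Isom_inv_comp)
qed

text \<open>
  By left invariance, \<open>\<phi> \<circ> \<psi>\<close> is as far from \<open>\<phi>\<close> as \<open>\<psi>\<close> is from the identity; the factor
  is the cost of the remaining right multiplication by \<open>inv \<phi>\<close>.
\<close>

lemma isom_dist_conj_id_le:
  assumes "\<phi> \<in> Isom" "\<psi> \<in> Isom"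
  shows "isom_dist ori (\<phi> \<circ> \<psi> \<circ> inv_into UNIV \<phi>) id \<le> isom_dist ori \<psi> id * (1 + isom_dist ori \<phi> id)"
proof -
  have "isom_dist ori (\<phi> \<circ> \<psi> \<circ> inv_into UNIV \<phi>) id \<le> isom_dist ori (\<phi> \<circ> \<psi>) \<phi> * (1 + dist (\<phi> ori) ori)"
    using isom_dist_comp_inv_id_le[OF assms(1) Isom_comp[OF assms]] .
  also have "isom_dist ori (\<phi> \<circ> \<psi>) \<phi> = isom_dist ori \<psi> id"
    using isom_dist_left_mult[OF assms Isom_id, of ori] by simp
  finally show ?thesis
    using dist_ori_le_isom_dist[OF assms(1), of ori] isom_dist_nonneg[of ori \<psi> id]
    by (smt (verit) mult_left_mono)
qed


section \<open>Images of tilings under isometries\<close>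

lemma tiling_image_comp: "tiling_image (\<phi> \<circ> \<psi>) S = tiling_image \<phi> (tiling_image \<psi> S)"
  by (simp add: tiling_image_def image_image image_comp)

lemma tiling_image_id: "tiling_image id S = S"
  by (simp add: tiling_image_def)

lemma tiling_image_inv:
  assumes "\<phi> \<in> Isom"
  shows "tiling_image (inv_into UNIV \<phi>) (tiling_image \<phi> S) = S"
  using assms by (simp add: Isom_inv_comp tiling_image_id flip: tiling_image_comp)

lemma hyperplane_face_isom:
  assumes \<phi>: "\<phi> \<in> Isom" and F: "hyperplane_face F P"
  shows "hyperplane_face (\<phi> ` F) (\<phi> ` P)"
proof (cases "F = {}")
  case False
  then obtain a b where a: "a \<noteq> 0" and P: "P \<subseteq> {x. a \<bullet> x \<le> b}" "P \<inter> {x. a \<bullet> x = b} \<noteq> {}"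
    and F: "F = P \<inter> {x. a \<bullet> x = b}"
    using F unfolding hyperplane_face_def by auto
  define A where "A = orth_part 0 \<phi>"
  have A: "orthogonal_transformation A"
    unfolding A_def by (rule isom_decomposition(1)[OF \<phi>])
  have "\<phi> x = \<phi> 0 + A x" for x
    by (simp add: A_def orth_part_def)
  then have "A a \<bullet> \<phi> x = a \<bullet> x + A a \<bullet> \<phi> 0" for x
    using A by (metis add.commute inner_add_right orthogonal_transformation_def)
  then obtain d where inner: "A a \<bullet> \<phi> x = a \<bullet> x + d" for x
    by blast
  have "A a \<noteq> 0"
    using A a by (metis norm_eq_zero orthogonal_transformation)
  moreover have "\<phi> ` P \<subseteq> {x. A a \<bullet> x \<le> b + d}"
    using P(1) by (auto simp: inner)
  moreover have eq: "\<phi> ` F = \<phi> ` P \<inter> {x. A a \<bullet> x = b + d}"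
    unfolding F by (auto simp: inner)
  moreover have "\<phi> ` P \<inter> {x. A a \<bullet> x = b + d} \<noteq> {}"
    using False eq by auto
  ultimately show ?thesis
    unfolding hyperplane_face_def by blast
qed (simp add: hyperplane_face_def)

lemma polytope_isom:
  assumes \<phi>: "\<phi> \<in> Isom" and P: "polytope P"
  shows "polytope (\<phi> ` P)" and "aff_dim (\<phi> ` P) = aff_dim P"
proof -
  define A where "A = orth_part 0 \<phi>"
  have A: "orthogonal_transformation A"
    unfolding A_def by (rule isom_decomposition(1)[OF \<phi>])
  have lin: "linear A" and inj: "inj A"
    using A orthogonal_transformation_linear orthogonal_transformation_inj by blast+
  have eq: "\<phi> ` P = (+) (\<phi> 0) ` A ` P"
    by (simp add: image_image A_def orth_part_def)
  show "polytope (\<phi> ` P)"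
    unfolding eq polytope_translation_eq using lin P by (rule polytope_linear_image)
  show "aff_dim (\<phi> ` P) = aff_dim P"
    unfolding eq aff_dim_translation_eq using lin inj by simp
qed

lemma tiling_tiling_image:
  assumes \<phi>: "\<phi> \<in> Isom" and T: "tiling T"
  shows "tiling (tiling_image \<phi> T)"
  unfolding tiling_def
proof (intro conjI ballI impI)
  fix t assume "t \<in> tiling_image \<phi> T"
  then show "polytope t" "aff_dim t = int DIM('a)"
    using T polytope_isom[OF \<phi>] by (auto simp: tiling_image_def tiling_def)
next
  have "\<Union>(tiling_image \<phi> T) = \<phi> ` \<Union>T"
    by (auto simp: tiling_image_def)
  then show "\<Union>(tiling_image \<phi> T) = UNIV"
    using T Isom_surj[OF \<phi>] by (simp add: tiling_def)
next
  fix s t assume "s \<in> tiling_image \<phi> T" "t \<in> tiling_image \<phi> T" "s \<noteq> t"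
  then obtain s' t' where st: "s' \<in> T" "t' \<in> T" "s' \<noteq> t'" "s = \<phi> ` s'" "t = \<phi> ` t'"
    by (auto simp: tiling_image_def)
  then have "hyperplane_face (s' \<inter> t') s'" "hyperplane_face (s' \<inter> t') t'"
    using T by (auto simp: tiling_def)
  moreover have "s \<inter> t = \<phi> ` (s' \<inter> t')"
    using st Isom_inj[OF \<phi>] by (simp add: image_Int)
  ultimately show "hyperplane_face (s \<inter> t) s" "hyperplane_face (s \<inter> t) t"
    using hyperplane_face_isom[OF \<phi>] st by auto
qed

lemma simple_tiling_tiling_image:
  assumes \<phi>: "\<phi> \<in> Isom" and T: "simple_tiling T"
  shows "simple_tiling (tiling_image \<phi> T)"
proof -
  obtain P where P: "finite P" "\<forall>p\<in>P. polytope p" "\<forall>t\<in>T. \<exists>p\<in>P. \<exists>\<psi>\<in>Isom. t = \<psi> ` p"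
    using T by (auto simp: simple_tiling_def)
  have "\<forall>t\<in>tiling_image \<phi> T. \<exists>p\<in>P. \<exists>\<psi>\<in>Isom. t = \<psi> ` p"
  proof
    fix t assume "t \<in> tiling_image \<phi> T"
    then obtain p \<psi> where "p \<in> P" "\<psi> \<in> Isom" "t = \<phi> ` \<psi> ` p"
      using P(3) by (auto simp: tiling_image_def)
    then show "\<exists>p\<in>P. \<exists>\<psi>\<in>Isom. t = \<psi> ` p"
      using Isom_comp[OF \<phi>] by (metis image_comp)
  qed
  then show ?thesis
    using P(1,2) tiling_tiling_image[OF \<phi>] T by (auto simp: simple_tiling_def)
qed

text \<open>
  The ball of radius \<open>r\<close> is contained in the image under \<open>\<xi>\<close> of the ball of radius \<open>r'\<close>, so
  an agreement can be moved by \<open>\<xi>\<close> at the price of shrinking the radius.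
\<close>

lemma tiles_meeting_cball_tiling_image:
  assumes \<xi>: "\<xi> \<in> Isom"
    and eq: "tiles_meeting X (cball ori r') = tiles_meeting Y (cball ori r')"
    and r: "r + dist (\<xi> ori) ori \<le> r'"
  shows "tiles_meeting (tiling_image \<xi> X) (cball ori r) =
         tiles_meeting (tiling_image \<xi> Y) (cball ori r)"
proof -
  have sub: "cball ori r \<subseteq> \<xi> ` cball ori r'"
  proof
    fix y assume "y \<in> cball ori r"
    moreover obtain x where x: "y = \<xi> x"
      using Isom_surj[OF \<xi>] by (metis surjD)
    ultimately have "dist ori x \<le> r'"
      using r Isom_dist[OF \<xi>, of ori x] dist_triangle[of "\<xi> ori" y ori] by simp
    then show "y \<in> \<xi> ` cball ori r'"
      using x by auto
  qed
  have "tiles_meeting (tiling_image \<xi> X) (cball ori r) \<subseteq>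
      tiles_meeting (tiling_image \<xi> Y) (cball ori r)"
    if eq: "tiles_meeting X (cball ori r') = tiles_meeting Y (cball ori r')" for X Y
  proof
    fix t assume "t \<in> tiles_meeting (tiling_image \<xi> X) (cball ori r)"
    then obtain s where s: "s \<in> X" "t = \<xi> ` s" "t \<inter> cball ori r \<noteq> {}"
      by (auto simp: tiles_meeting_def tiling_image_def)
    then obtain x where x: "x \<in> s" "\<xi> x \<in> cball ori r"
      by blast
    then have "x \<in> cball ori r'"
      using sub inj_image_mem_iff[OF Isom_inj[OF \<xi>]] by blast
    with x(1) s(1) have "s \<in> tiles_meeting X (cball ori r')"
      by (auto simp: tiles_meeting_def)
    then have "s \<in> Y"
      unfolding eq by (simp add: tiles_meeting_def)
    with s show "t \<in> tiles_meeting (tiling_image \<xi> Y) (cball ori r)"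
      by (auto simp: tiles_meeting_def tiling_image_def)
  qed
  then show ?thesis
    using eq eq[symmetric] by blast
qed


section \<open>The distance of tilings is a metric\<close>

definition agree_up_to :: "'a::euclidean_space \<Rightarrow> real \<Rightarrow> 'a set set \<Rightarrow> 'a set set \<Rightarrow> bool" where
  "agree_up_to ori r S S' \<longleftrightarrow>
     (\<exists>\<phi>\<in>Isom. \<exists>\<psi>\<in>Isom.
        isom_dist ori \<phi> id < 1 / (2 * r) \<and> isom_dist ori \<psi> id < 1 / (2 * r) \<and>
        tiles_meeting (tiling_image \<phi> S) (cball ori r) =
        tiles_meeting (tiling_image \<psi> S') (cball ori r))"

lemma agree_up_to_sym: "agree_up_to ori r S S' \<Longrightarrow> agree_up_to ori r S' S"
  unfolding agree_up_to_def by metis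

text \<open>The isometry \<open>\<psi> \<circ> inv \<phi>\<close>, which carries one tiling onto the other, is close to the identity.\<close>

lemma agree_up_to_close_isoms:
  assumes \<phi>: "\<phi> \<in> Isom" and \<psi>: "\<psi> \<in> Isom" and r: "0 < r"
    and close: "isom_dist ori \<psi> \<phi> * (1 + dist (\<phi> ori) ori) < 1 / (2 * r)"
  shows "agree_up_to ori r (tiling_image \<phi> T) (tiling_image \<psi> T)"
proof -
  have "isom_dist ori (\<psi> \<circ> inv_into UNIV \<phi>) id < 1 / (2 * r)"
    using isom_dist_comp_inv_id_le[OF \<phi> \<psi>, of ori] close by linarith
  moreover have "isom_dist ori id id < 1 / (2 * r)"
    using r by (simp add: isom_dist_def)
  moreover have "tiling_image (\<psi> \<circ> inv_into UNIV \<phi>) (tiling_image \<phi> T) = tiling_image id (tiling_image \<psi> T)"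
    by (simp add: tiling_image_comp tiling_image_inv[OF \<phi>] tiling_image_id)
  ultimately show ?thesis
    unfolding agree_up_to_def using Isom_comp[OF \<psi> Isom_inv[OF \<phi>]] Isom_id by metis
qed

lemma agree_up_to_refl:
  assumes "0 < r"
  shows "agree_up_to ori r S S"
  using agree_up_to_close_isoms[OF Isom_id Isom_id assms, of ori S] assms
  by (simp add: tiling_image_id isom_dist_def)

text \<open>
  The radius \<open>r\<close> in the conclusion is the solution of
  \<open>1 + 1 / r = (1 + 1 / r1) (1 + 1 / r2)\<close>, which turns into additivity of \<open>ln (1 + 1 / r)\<close>.
  The lower bounds on \<open>r1\<close> and \<open>r2\<close> ensure that the displacements of the origin by the
  auxiliary isometries cost no more radius than \<open>r1 - r\<close> and \<open>r2 - r\<close>.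
\<close>

lemma agree_up_to_trans:
  assumes "agree_up_to ori r1 S S'" "agree_up_to ori r2 S' S''" and r1: "2 \<le> r1" and r2: "2 \<le> r2"
  shows "agree_up_to ori (r1 * r2 / (r1 + r2 + 1)) S S''"
proof -
  define r where "r = r1 * r2 / (r1 + r2 + 1)"
  obtain \<phi>1 \<psi>1 where \<phi>1: "\<phi>1 \<in> Isom" "isom_dist ori \<phi>1 id < 1 / (2 * r1)"
    and \<psi>1: "\<psi>1 \<in> Isom" "isom_dist ori \<psi>1 id < 1 / (2 * r1)"
    and eq1: "tiles_meeting (tiling_image \<phi>1 S) (cball ori r1) =
      tiles_meeting (tiling_image \<psi>1 S') (cball ori r1)"
    using assms(1) unfolding agree_up_to_def by blast
  obtain \<phi>2 \<psi>2 where \<phi>2: "\<phi>2 \<in> Isom" "isom_dist ori \<phi>2 id < 1 / (2 * r2)"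
    and \<psi>2: "\<psi>2 \<in> Isom" "isom_dist ori \<psi>2 id < 1 / (2 * r2)"
    and eq2: "tiles_meeting (tiling_image \<phi>2 S') (cball ori r2) =
      tiles_meeting (tiling_image \<psi>2 S'') (cball ori r2)"
    using assms(2) unfolding agree_up_to_def by blast
  define \<kappa> where "\<kappa> = \<phi>2 \<circ> \<psi>1 \<circ> inv_into UNIV \<phi>2"
  have \<kappa>: "\<kappa> \<in> Isom"
    unfolding \<kappa>_def using \<phi>2(1) \<psi>1(1) by (intro Isom_comp Isom_inv)
  have d\<kappa>: "isom_dist ori \<kappa> id \<le> 1 / (2 * r1) * (1 + 1 / (2 * r2))"
  proof -
    have "isom_dist ori \<kappa> id \<le> isom_dist ori \<psi>1 id * (1 + isom_dist ori \<phi>2 id)"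
      unfolding \<kappa>_def using \<phi>2(1) \<psi>1(1) by (rule isom_dist_conj_id_le)
    also have "\<dots> \<le> 1 / (2 * r1) * (1 + 1 / (2 * r2))"
      using \<psi>1(2) \<phi>2(2) r1 isom_dist_nonneg[of ori \<phi>2 id] by (intro mult_mono) auto
    finally show ?thesis .
  qed
  have r_inv: "1 / (2 * r) = 1 / (2 * r1) + 1 / (2 * r2) + 1 / (2 * r1 * r2)"
    using r1 r2 by (simp add: r_def field_simps)
  have r1_le: "2 * r1 \<le> r1 * r2" and r2_le: "2 * r2 \<le> r1 * r2"
    using r1 r2 by simp_all
  have prod_le: "2 * (r1 * r2) \<le> r1 * (r1 * r2)" "2 * (r1 * r2) \<le> r2 * (r1 * r2)"
    using r1 r2 by (auto intro!: mult_right_mono)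
  have bound1: "r + 1 / (2 * r2) \<le> r1"
  proof -
    have "2 * r2 * (r1 * (r1 + 1)) = 2 * (r1 * (r1 * r2)) + 2 * (r1 * r2)"
      by (simp add: algebra_simps)
    then have "r1 + r2 + 1 \<le> 2 * r2 * (r1 * (r1 + 1))"
      using r1 r2 r1_le r2_le prod_le by linarith
    then have "1 / (2 * r2) \<le> r1 * (r1 + 1) / (r1 + r2 + 1)"
      using r1 r2 by (simp add: field_simps)
    also have "\<dots> = r1 - r"
      using r1 r2 by (simp add: r_def field_simps)
    finally show ?thesis by simp
  qed
  have bound2: "r + 1 / (2 * r1) * (1 + 1 / (2 * r2)) \<le> r2"
  proof -
    have "1 / (2 * r1) * (1 + 1 / (2 * r2)) \<le> 1 / (2 * r1) * (3 / 2)"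
      using r1 r2 by (intro mult_left_mono) (auto simp: field_simps)
    also have "\<dots> \<le> r2 * (r2 + 1) / (r1 + r2 + 1)"
    proof -
      \<comment> \<open>The products are generalised to variables to make the inequality linear.\<close>
      have "3 * (r1 + r2 + 1) \<le> 4 * q + 4 * p" if "2 * r1 \<le> p" "2 * r2 \<le> p" "2 * p \<le> q" for p q
        using that r1 by argo
      note this[OF r1_le r2_le prod_le(2)]
      also have "4 * (r2 * (r1 * r2)) + 4 * (r1 * r2) = 4 * r1 * (r2 * (r2 + 1))"
        by (simp add: algebra_simps)
      finally show ?thesis
        using r1 r2 by (simp add: field_simps)
    qed
    also have "\<dots> = r2 - r"
      using r1 r2 by (simp add: r_def field_simps)
    finally show ?thesis by simp
  qed
  have "isom_dist ori (\<phi>2 \<circ> \<phi>1) id < 1 / (2 * r)"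
  proof -
    have "0 < 1 / (2 * r1 * r2)" using r1 r2 by simp
    then show ?thesis
      using isom_dist_comp_id_le[OF \<phi>2(1) \<phi>1(1), of ori] \<phi>1(2) \<phi>2(2) unfolding r_inv by linarith
  qed
  moreover have "isom_dist ori (\<kappa> \<circ> \<psi>2) id < 1 / (2 * r)"
  proof -
    have "1 / (2 * r1) * (1 + 1 / (2 * r2)) + 1 / (2 * r2) \<le> 1 / (2 * r)"
      unfolding r_inv using r1 r2 by (simp add: field_simps)
    then show ?thesis
      using isom_dist_comp_id_le[OF \<kappa> \<psi>2(1), of ori] d\<kappa> \<psi>2(2) by linarith
  qed
  moreover have "tiles_meeting (tiling_image (\<phi>2 \<circ> \<phi>1) S) (cball ori r) =
      tiles_meeting (tiling_image (\<kappa> \<circ> \<psi>2) S'') (cball ori r)"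
  proof -
    have "tiles_meeting (tiling_image (\<phi>2 \<circ> \<phi>1) S) (cball ori r) =
        tiles_meeting (tiling_image (\<phi>2 \<circ> \<psi>1) S') (cball ori r)"
      unfolding tiling_image_comp
      using dist_ori_le_isom_dist[OF \<phi>2(1), of ori] \<phi>2(2) bound1
      by (intro tiles_meeting_cball_tiling_image[OF \<phi>2(1) eq1]) linarith
    also have "\<phi>2 \<circ> \<psi>1 = \<kappa> \<circ> \<phi>2"
      unfolding \<kappa>_def using Isom_inv_comp(1)[OF \<phi>2(1)] by (simp add: comp_assoc)
    also have "tiles_meeting (tiling_image (\<kappa> \<circ> \<phi>2) S') (cball ori r) =
        tiles_meeting (tiling_image (\<kappa> \<circ> \<psi>2) S'') (cball ori r)"
      unfolding tiling_image_comp
      using dist_ori_le_isom_dist[OF \<kappa>, of ori] d\<kappa> bound2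
      by (intro tiles_meeting_cball_tiling_image[OF \<kappa> eq2]) linarith
    finally show ?thesis .
  qed
  ultimately show ?thesis
    unfolding agree_up_to_def r_def[symmetric]
    using Isom_comp[OF \<phi>2(1) \<phi>1(1)] Isom_comp[OF \<kappa> \<psi>2(1)] by blast
qed

lemma ennreal_inverse_antimono: "x \<le> y \<Longrightarrow> inverse y \<le> inverse (x :: ennreal)"
  including ennreal.lifting by transfer (rule ereal_inverse_antimono)

text \<open>
  A description of the balls without the supremum and without the conventions about \<open>0\<close> and \<open>\<infinity>\<close>.
\<close>

lemma tiling_dist_less_iff:
  "tiling_dist ori S S' < e \<longleftrightarrow>
     ln (3 / 2) < e \<or> (\<exists>r>0. agree_up_to ori r S S' \<and> ln (1 + 1 / r) < e)"
proof -
  define R where "R = agreement_radius ori S S'"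
  have R: "R = Sup {ennreal r | r. 0 < r \<and> agree_up_to ori r S S'}"
    by (simp add: R_def agreement_radius_def agree_up_to_def)
  have dist: "tiling_dist ori S S' =
      (if R = 0 then ln (3 / 2) else min (ln (3 / 2)) (ln (1 + enn2real (inverse R))))"
    by (simp add: tiling_dist_def R_def)
  show ?thesis
  proof
    assume less: "tiling_dist ori S S' < e"
    show "ln (3 / 2) < e \<or> (\<exists>r>0. agree_up_to ori r S S' \<and> ln (1 + 1 / r) < e)"
    proof (cases "ln (3 / 2) < e")
      case False
      define c where "c = enn2real (inverse R)"
      define b where "b = exp e - 1"
      have R0: "R \<noteq> 0" and ln_c: "ln (1 + c) < e"
        using less False by (auto simp: dist c_def min_def split: if_splits)
      have c0: "0 \<le> c" by (simp add: c_def)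
      have "1 + c < exp e"
        using ln_c c0 by (metis add_pos_nonneg exp_less_cancel_iff exp_ln zero_less_one)
      then have cb: "c < b"
        by (simp add: b_def)
      then have b0: "0 < b"
        using c0 by linarith
      have "inverse R = ennreal c"
        using R0 unfolding c_def by (simp add: less_top[symmetric])
      with cb c0 have "inverse R < ennreal b"
        by (simp add: ennreal_less_iff)
      moreover have "inverse (ennreal (1 / b)) = ennreal b"
        using b0 by (simp add: inverse_ennreal)
      ultimately have "ennreal (1 / b) < R"
        using ennreal_inverse_antimono[of R "ennreal (1 / b)"] by (metis linorder_not_le)
      then obtain r where r: "0 < r" "agree_up_to ori r S S'" "ennreal (1 / b) < ennreal r"
        unfolding R less_Sup_iff by blast
      then have "1 / b < r"
        using b0 by (simp add: ennreal_less_iff)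
      then have "1 / r < b"
        using b0 r(1) by (simp add: field_simps)
      then have "1 + 1 / r < exp e"
        by (simp add: b_def)
      then have "ln (1 + 1 / r) < e"
        using r(1) by (metis add_pos_pos exp_less_cancel_iff exp_ln zero_less_divide_1_iff zero_less_one)
      with r show ?thesis by blast
    qed simp
  next
    assume "ln (3 / 2) < e \<or> (\<exists>r>0. agree_up_to ori r S S' \<and> ln (1 + 1 / r) < e)"
    then show "tiling_dist ori S S' < e"
    proof
      assume "\<exists>r>0. agree_up_to ori r S S' \<and> ln (1 + 1 / r) < e"
      then obtain r where r: "0 < r" "agree_up_to ori r S S'" "ln (1 + 1 / r) < e" by blast
      then have rR: "ennreal r \<le> R"
        unfolding R by (intro Sup_upper) blast
      then have R0: "R \<noteq> 0"
        using r(1) by auto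
      have "inverse R \<le> inverse (ennreal r)"
        using rR by (rule ennreal_inverse_antimono)
      also have "\<dots> = ennreal (1 / r)"
        using r(1) by (simp add: inverse_ennreal divide_inverse)
      finally have "enn2real (inverse R) \<le> 1 / r"
        using r(1) by (simp add: enn2real_leI)
      then have "ln (1 + enn2real (inverse R)) \<le> ln (1 + 1 / r)"
        using r(1) by (subst ln_le_cancel_iff) (auto intro: add_pos_nonneg add_pos_pos)
      with r(3) R0 show ?thesis by (simp add: dist)
    qed (simp add: dist min_def)
  qed
qed

lemma tiling_dist_le: "tiling_dist ori S S' \<le> ln (3 / 2)"
  by (simp add: tiling_dist_def Let_def)

lemma tiling_dist_nonneg: "0 \<le> tiling_dist ori S S'"
  by (simp add: tiling_dist_def Let_def)

lemma tiling_dist_commute: "tiling_dist ori S S' = tiling_dist ori S' S"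
proof -
  have "tiling_dist ori S S' < e \<longleftrightarrow> tiling_dist ori S' S < e" for e
    unfolding tiling_dist_less_iff using agree_up_to_sym by blast
  then show ?thesis by (meson less_irrefl linorder_neqE)
qed

lemma tiling_dist_triangle:
  "tiling_dist ori S S'' \<le> tiling_dist ori S S' + tiling_dist ori S' S''"
proof (rule ccontr)
  assume "\<not> ?thesis"
  then obtain e1 where e1: "tiling_dist ori S S' < e1"
    and e1': "e1 < tiling_dist ori S S'' - tiling_dist ori S' S''"
    by (metis dense less_diff_eq linorder_not_le)
  define e2 where "e2 = tiling_dist ori S S'' - e1"
  have e2: "tiling_dist ori S' S'' < e2"
    using e1' by (simp add: e2_def)
  have le: "e1 \<le> ln (3 / 2)" "e2 \<le> ln (3 / 2)"
    using e1 e2 tiling_dist_le[of ori S S''] tiling_dist_nonneg[of ori S S']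
      tiling_dist_nonneg[of ori S' S''] by (simp_all add: e2_def)
  obtain r1 where r1: "0 < r1" "agree_up_to ori r1 S S'" "ln (1 + 1 / r1) < e1"
    using e1 le(1) unfolding tiling_dist_less_iff by auto
  obtain r2 where r2: "0 < r2" "agree_up_to ori r2 S' S''" "ln (1 + 1 / r2) < e2"
    using e2 le(2) unfolding tiling_dist_less_iff by auto
  \<comment> \<open>The cut-off at \<open>ln (3 / 2)\<close> leaves only radii greater than \<open>2\<close>.\<close>
  have large: "2 \<le> r" if "0 < r" "ln (1 + 1 / r) < ln (3 / 2)" for r :: real
  proof -
    have "1 + 1 / r < 3 / 2"
      using that by (metis add_pos_pos ln_less_cancel_iff zero_less_divide_1_iff zero_less_one
          zero_less_divide_iff zero_less_numeral)
    then show ?thesis using that(1) by (simp add: field_simps)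
  qed
  define r where "r = r1 * r2 / (r1 + r2 + 1)"
  have "agree_up_to ori r S S''"
    unfolding r_def using r1 r2 le by (intro agree_up_to_trans[of _ _ _ S'] large) auto
  moreover have "1 + 1 / r = (1 + 1 / r1) * (1 + 1 / r2)"
    using r1(1) r2(1) by (simp add: r_def field_simps)
  then have "ln (1 + 1 / r) = ln (1 + 1 / r1) + ln (1 + 1 / r2)"
    using r1(1) r2(1) by (simp add: ln_mult_pos add_pos_pos)
  then have "ln (1 + 1 / r) < tiling_dist ori S S''"
    using r1(3) r2(3) by (simp add: e2_def)
  moreover have "0 < r"
    using r1(1) r2(1) by (simp add: r_def)
  ultimately have "tiling_dist ori S S'' < tiling_dist ori S S''"
    using tiling_dist_less_iff by blast
  then show False by simp
qed

lemma tile_has_ball: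
  fixes T :: "'a::euclidean_space set set"
  assumes "tiling T" "t \<in> T"
  obtains c \<rho> where "0 < \<rho>" "ball c \<rho> \<subseteq> t"
proof -
  have t: "polytope t" "aff_dim t = int DIM('a)"
    using assms by (auto simp: tiling_def)
  have "t \<noteq> {}" using t(2) by auto
  moreover have "rel_interior t = interior t"
    using t(2) by (simp add: aff_dim_eq_full rel_interior_interior)
  ultimately have "interior t \<noteq> {}"
    using rel_interior_eq_empty polytope_imp_convex t(1) by metis
  then show ?thesis
    using that by (metis ex_in_conv mem_interior)
qed

text \<open>A common face lies in a hyperplane, which contains no ball.\<close>

lemma overlapping_tiles_eq:
  assumes T: "tiling T" and st: "s \<in> T" "t \<in> T" and \<rho>: "0 < \<rho>" "ball c \<rho> \<subseteq> s" "ball c \<rho> \<subseteq> t"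
  shows "s = t"
proof (rule ccontr)
  assume "s \<noteq> t"
  then have "hyperplane_face (s \<inter> t) s"
    using T st by (auto simp: tiling_def)
  moreover have "c \<in> s \<inter> t"
    using \<rho> by auto
  ultimately obtain a b where "a \<noteq> 0" "s \<inter> t \<subseteq> {x. a \<bullet> x = b}"
    unfolding hyperplane_face_def by blast
  moreover have "c \<in> interior (s \<inter> t)"
    using \<rho> by (meson Int_greatest mem_interior)
  ultimately show False
    using interior_hyperplane interior_mono by (metis empty_iff subsetD)
qed

text \<open>
  On a ball that meets \<open>\<phi> ` t\<close>, an agreement of \<open>\<phi>(S)\<close> with \<open>\<psi>(S')\<close> makes \<open>inv \<psi> \<circ> \<phi>\<close> carry
  \<open>t\<close> to a tile of \<open>S'\<close>.
\<close>

lemma small_isom_carries_tile: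
  assumes agree: "\<And>r0. \<exists>r\<ge>r0. agree_up_to ori r S S'"
    and t: "t \<in> S" "t \<noteq> {}" and \<delta>: "0 < \<delta>"
  obtains \<xi> where "\<xi> \<in> Isom" "isom_dist ori \<xi> id < \<delta>" "\<xi> ` t \<in> S'"
proof -
  obtain x where x: "x \<in> t" using t by blast
  obtain r where r: "r \<ge> max (dist x ori + 1) (1 / \<delta>)" and "agree_up_to ori r S S'"
    using agree by blast
  then obtain \<phi> \<psi> where \<phi>: "\<phi> \<in> Isom" "isom_dist ori \<phi> id < 1 / (2 * r)"
    and \<psi>: "\<psi> \<in> Isom" "isom_dist ori \<psi> id < 1 / (2 * r)"
    and eq: "tiles_meeting (tiling_image \<phi> S) (cball ori r) =
      tiles_meeting (tiling_image \<psi> S') (cball ori r)"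
    unfolding agree_up_to_def by blast
  have r1: "1 \<le> r" "dist x ori + 1 \<le> r" "1 / \<delta> \<le> r"
    using r zero_le_dist[of x ori] by linarith+
  have "dist (\<phi> ori) ori \<le> 1"
  proof -
    have "1 / (2 * r) \<le> 1" using r1 by simp
    then show ?thesis using dist_ori_le_isom_dist[OF \<phi>(1), of ori] \<phi>(2) by linarith
  qed
  then have "dist ori (\<phi> x) \<le> r"
    using Isom_dist[OF \<phi>(1), of x ori] r1(2) dist_triangle[of "\<phi> x" ori "\<phi> ori"]
    by (simp add: dist_commute)
  then have "\<phi> ` t \<in> tiles_meeting (tiling_image \<phi> S) (cball ori r)"
    using x t by (auto simp: tiles_meeting_def tiling_image_def)
  then obtain s where s: "s \<in> S'" "\<phi> ` t = \<psi> ` s"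
    unfolding eq by (auto simp: tiles_meeting_def tiling_image_def)
  have "(inv_into UNIV \<psi> \<circ> \<phi>) ` t = inv_into UNIV \<psi> ` \<psi> ` s"
    unfolding s(2)[symmetric] by (rule image_comp[symmetric])
  then have "(inv_into UNIV \<psi> \<circ> \<phi>) ` t = s"
    using Isom_inj[OF \<psi>(1)] by (simp only: image_inv_f_f)
  moreover have "isom_dist ori (inv_into UNIV \<psi> \<circ> \<phi>) id < \<delta>"
  proof -
    have "isom_dist ori (inv_into UNIV \<psi> \<circ> \<phi>) id \<le> isom_dist ori \<phi> id + isom_dist ori \<psi> id"
      using isom_dist_inv_comp_id[OF \<psi>(1) \<phi>(1), of ori] isom_dist_triangle[of ori \<phi> \<psi> id]
      by (simp add: isom_dist_commute[of ori id \<psi>])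
    also have "\<dots> < 1 / r"
      using \<phi>(2) \<psi>(2) by (simp add: field_simps)
    also have "1 / r \<le> \<delta>"
      using r1 \<delta> by (simp add: field_simps)
    finally show ?thesis .
  qed
  ultimately show ?thesis
    using that s(1) Isom_comp[OF Isom_inv[OF \<psi>(1)] \<phi>(1)] by metis
qed

text \<open>
  Isometries close to the identity move the centre \<open>c\<close> of a ball of radius \<open>\<rho>\<close> inside \<open>t\<close> by less than
  \<open>\<rho> / 2\<close>, so all tiles of \<open>S'\<close> to which they carry \<open>t\<close> contain the ball of radius \<open>\<rho> / 2\<close>
  around \<open>c\<close> and therefore coincide.
\<close>

lemma tile_transfer:
  assumes S: "tiling S" and S': "tiling S'"
    and agree: "\<And>r0. \<exists>r\<ge>r0. agree_up_to ori r S S'" and t: "t \<in> S"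
  shows "t \<in> S'"
proof -
  obtain c \<rho> where \<rho>: "0 < \<rho>" "ball c \<rho> \<subseteq> t"
    using tile_has_ball[OF S t] .
  have t_ne: "t \<noteq> {}" using \<rho> by auto
  define \<delta>0 where "\<delta>0 = \<rho> / 2 / (1 + dist c ori)"
  have den: "0 < 1 + dist y ori" for y
    using zero_le_dist[of y ori] by linarith
  have \<delta>0: "0 < \<delta>0"
    unfolding \<delta>0_def using \<rho>(1) den[of c] by (intro divide_pos_pos) simp_all
  have contains: "ball c (\<rho> / 2) \<subseteq> \<xi> ` t" if \<xi>: "\<xi> \<in> Isom" "isom_dist ori \<xi> id < \<delta>0" for \<xi>
  proof
    have "dist (\<xi> c) c \<le> isom_dist ori \<xi> id * (1 + dist c ori)"
      using dist_le_isom_dist[OF \<xi>(1) Isom_id, where x = c and ori = ori] by simp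
    also have "\<dots> < \<delta>0 * (1 + dist c ori)"
      using \<xi>(2) den by simp
    also have "\<dots> = \<rho> / 2"
      unfolding \<delta>0_def by (metis den less_irrefl nonzero_eq_divide_eq)
    finally have c: "dist (\<xi> c) c < \<rho> / 2" .
    fix y assume y: "y \<in> ball c (\<rho> / 2)"
    obtain x where x: "y = \<xi> x"
      using Isom_surj[OF \<xi>(1)] by (metis surjD)
    have "dist c x < \<rho>"
      using Isom_dist[OF \<xi>(1), of c x] c y x dist_triangle[of "\<xi> c" y c] by simp
    then show "y \<in> \<xi> ` t"
      using \<rho>(2) x by auto
  qed
  obtain \<xi>0 where \<xi>0: "\<xi>0 \<in> Isom" "isom_dist ori \<xi>0 id < \<delta>0" "\<xi>0 ` t \<in> S'"
    using small_isom_carries_tile[OF agree t t_ne \<delta>0] .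
  define s where "s = \<xi>0 ` t"
  have small: "\<exists>\<xi>\<in>Isom. isom_dist ori \<xi> id < \<delta> \<and> \<xi> ` t = s" if "0 < \<delta>" for \<delta>
  proof -
    have "0 < min \<delta> \<delta>0"
      using that \<delta>0 by simp
    then obtain \<xi> where \<xi>: "\<xi> \<in> Isom" "isom_dist ori \<xi> id < min \<delta> \<delta>0" "\<xi> ` t \<in> S'"
      using small_isom_carries_tile[OF agree t t_ne] by metis
    then have "\<xi> ` t = s"
      unfolding s_def using \<xi>0 \<rho>(1) contains[of \<xi>] contains[of \<xi>0]
      by (intro overlapping_tiles_eq[OF S', of _ _ "\<rho> / 2" c]) auto
    with \<xi> show ?thesis by auto
  qed
  have near: "\<exists>\<xi>\<in>Isom. \<xi> ` t = s \<and> dist (\<xi> y) y < e \<and> dist (inv_into UNIV \<xi> y) y < e"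
    if e: "0 < e" for e y
  proof -
    define \<delta> where "\<delta> = e / (1 + dist y ori)"
    have "0 < \<delta>"
      unfolding \<delta>_def using e den by simp
    then obtain \<xi> where \<xi>: "\<xi> \<in> Isom" "isom_dist ori \<xi> id < \<delta>" "\<xi> ` t = s"
      using small by blast
    have "dist (\<xi> y) y \<le> isom_dist ori \<xi> id * (1 + dist y ori)"
      using dist_le_isom_dist[OF \<xi>(1) Isom_id, where x = y and ori = ori] by simp
    moreover have "isom_dist ori (inv_into UNIV \<xi>) id = isom_dist ori \<xi> id"
      using isom_dist_inv_comp_id[OF \<xi>(1) Isom_id, of ori] by (simp add: isom_dist_commute)
    then have "dist (inv_into UNIV \<xi> y) y \<le> isom_dist ori \<xi> id * (1 + dist y ori)"
      using dist_le_isom_dist[OF Isom_inv[OF \<xi>(1)] Isom_id, where x = y and ori = ori] by simp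
    moreover have "isom_dist ori \<xi> id * (1 + dist y ori) < e"
      using \<xi>(2) den[of y] by (simp add: \<delta>_def pos_less_divide_eq)
    ultimately show ?thesis
      using \<xi> by (intro bexI[of _ \<xi>]) auto
  qed
  have "closed t"
    using S t by (simp add: tiling_def polytope_imp_closed)
  have "closed s"
    using S' \<xi>0(3) by (simp add: tiling_def polytope_imp_closed s_def)
  have "t \<subseteq> s"
  proof
    fix x assume x: "x \<in> t"
    have "\<exists>y\<in>s. dist y x < e" if "0 < e" for e
      using near[OF that, of x] x by blast
    then show "x \<in> s"
      using \<open>closed s\<close> closed_approachable by blast
  qed
  moreover have "s \<subseteq> t"
  proof
    fix y assume y: "y \<in> s"
    have "\<exists>x\<in>t. dist x y < e" if e: "0 < e" for e
    proof -
      obtain \<xi> where \<xi>: "\<xi> \<in> Isom" "\<xi> ` t = s" "dist (inv_into UNIV \<xi> y) y < e"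
        using near[OF e, of y] by blast
      then have "inv_into UNIV \<xi> y \<in> t"
        using y Isom_inj by (metis image_inv_f_f imageI)
      with \<xi>(3) show ?thesis by blast
    qed
    then show "y \<in> t"
      using \<open>closed t\<close> closed_approachable by blast
  qed
  ultimately have "t = s" by blast
  then show ?thesis
    using \<xi>0(3) by (simp add: s_def)
qed

lemma tiling_dist_eq_0_imp_agree:
  assumes "tiling_dist ori S S' = 0"
  shows "\<exists>r\<ge>r0. agree_up_to ori r S S'"
proof -
  define R where "R = max r0 2"
  have R: "2 \<le> R" "r0 \<le> R" by (simp_all add: R_def)
  have "0 < ln (1 + 1 / R)"
    using R by (intro ln_gt_zero) simp
  moreover have le: "ln (1 + 1 / R) \<le> ln (3 / 2)"
    using R by (simp add: field_simps)
  ultimately obtain r where r: "0 < r" "agree_up_to ori r S S'" "ln (1 + 1 / r) < ln (1 + 1 / R)"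
    using assms tiling_dist_less_iff[of ori S S' "ln (1 + 1 / R)"] by auto
  have "1 + 1 / r < 1 + 1 / R"
    using r(1,3) R by (subst (asm) ln_less_cancel_iff) (auto intro: add_pos_pos)
  then have "R \<le> r"
    using r(1) R by (simp add: field_simps)
  then show ?thesis
    using r(2) R(2) by (meson order_trans)
qed

lemma tiling_dist_self: "tiling_dist ori S S = 0"
proof (rule ccontr)
  assume "tiling_dist ori S S \<noteq> 0"
  then have pos: "0 < tiling_dist ori S S"
    using tiling_dist_nonneg[of ori S S] by simp
  \<comment> \<open>The radius for which \<open>ln (1 + 1 / r)\<close> is half of the distance.\<close>
  define r where "r = 1 / (exp (tiling_dist ori S S / 2) - 1)"
  have "0 < r"
    using pos by (simp add: r_def)
  moreover have "ln (1 + 1 / r) < tiling_dist ori S S"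
    using pos by (simp add: r_def)
  ultimately have "tiling_dist ori S S < tiling_dist ori S S"
    using agree_up_to_refl tiling_dist_less_iff by blast
  then show False by simp
qed

theorem Metric_space_tiling_dist: "Metric_space {T. simple_tiling T} (tiling_dist ori)"
proof
  show "tiling_dist ori S S' = 0 \<longleftrightarrow> S = S'"
    if "S \<in> {T. simple_tiling T}" "S' \<in> {T. simple_tiling T}" for S S'
  proof
    assume 0: "tiling_dist ori S S' = 0"
    have tilings: "tiling S" "tiling S'"
      using that by (simp_all add: simple_tiling_def)
    have "t \<in> S'" if "t \<in> S" for t
      using tile_transfer[OF tilings tiling_dist_eq_0_imp_agree[OF 0] that] .
    moreover have "tiling_dist ori S' S = 0"
      using 0 by (simp add: tiling_dist_commute)
    then have "t \<in> S" if "t \<in> S'" for t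
      using tile_transfer[OF tilings(2,1) tiling_dist_eq_0_imp_agree that] by blast
    ultimately show "S = S'" by blast
  qed (simp add: tiling_dist_self)
qed (rule tiling_dist_nonneg tiling_dist_commute tiling_dist_triangle)+


section \<open>The orbit map and the hull\<close>

lemma continuous_map_orbit:
  assumes T: "simple_tiling T"
  shows "continuous_map (isom_topology ori) (tiling_topology ori) (\<lambda>\<phi>. tiling_image \<phi> T)"
proof -
  interpret I: Metric_space Isom "isom_dist ori" by (rule Metric_space_isom_dist)
  interpret M: Metric_space "{T. simple_tiling T}" "tiling_dist ori"
    by (rule Metric_space_tiling_dist)
  show ?thesis
    unfolding tiling_topology_def isom_topology_def M.continuous_map_to_metric
  proof (intro ballI allI impI)
    fix \<phi> and \<epsilon> :: real assume "\<phi> \<in> topspace I.mtopology" and \<epsilon>: "0 < \<epsilon>"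
    then have \<phi>: "\<phi> \<in> Isom" by simp
    \<comment> \<open>The radius for which \<open>ln (1 + 1 / r) = \<epsilon> / 2\<close>.\<close>
    define r where "r = 1 / (exp (\<epsilon> / 2) - 1)"
    have r: "0 < r" "ln (1 + 1 / r) < \<epsilon>"
      using \<epsilon> by (simp_all add: r_def)
    define \<delta> where "\<delta> = 1 / (2 * r) / (1 + dist (\<phi> ori) ori)"
    have den: "0 < 1 + dist (\<phi> ori) ori"
      using zero_le_dist[of "\<phi> ori" ori] by linarith
    have "0 < \<delta>"
      using r(1) den by (simp add: \<delta>_def)
    moreover have "tiling_image \<psi> T \<in> M.mball (tiling_image \<phi> T) \<epsilon>" if "\<psi> \<in> I.mball \<phi> \<delta>" for \<psi>
    proof -
      have \<psi>: "\<psi> \<in> Isom" "isom_dist ori \<psi> \<phi> < \<delta>"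
        using that by (auto simp: isom_dist_commute)
      then have "isom_dist ori \<psi> \<phi> * (1 + dist (\<phi> ori) ori) < 1 / (2 * r)"
        using den by (simp only: \<delta>_def pos_less_divide_eq)
      then have "tiling_dist ori (tiling_image \<phi> T) (tiling_image \<psi> T) < \<epsilon>"
        unfolding tiling_dist_less_iff
        using r agree_up_to_close_isoms[OF \<phi> \<psi>(1) r(1)] by blast
      then show ?thesis
        using simple_tiling_tiling_image[OF _ T] \<phi> \<psi>(1) by simp
    qed
    ultimately show "\<exists>U. openin I.mtopology U \<and> \<phi> \<in> U \<and>
        (\<forall>\<psi>\<in>U. tiling_image \<psi> T \<in> M.mball (tiling_image \<phi> T) \<epsilon>)"
      using \<phi> by (intro exI[of _ "I.mball \<phi> \<delta>"]) auto
  qed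
qed

lemma tiling_image_eq_iff_coset_eq:
  assumes sub: "subgroup (tiling_aut T) isom_group" and \<phi>: "\<phi> \<in> Isom" and \<psi>: "\<psi> \<in> Isom"
  shows "tiling_image \<phi> T = tiling_image \<psi> T \<longleftrightarrow>
    \<phi> <#\<^bsub>isom_group\<^esub> tiling_aut T = \<psi> <#\<^bsub>isom_group\<^esub> tiling_aut T"
proof
  interpret group isom_group by (rule group_isom_group)
  have coset: "\<xi> <#\<^bsub>isom_group\<^esub> tiling_aut T = {\<xi> \<circ> \<gamma> | \<gamma>. \<gamma> \<in> tiling_aut T}" for \<xi>
    by (auto simp: l_coset_def isom_group_def)
  show "\<phi> <#\<^bsub>isom_group\<^esub> tiling_aut T = \<psi> <#\<^bsub>isom_group\<^esub> tiling_aut T"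
    if eq: "tiling_image \<phi> T = tiling_image \<psi> T"
  proof (rule l_repr_independence[OF _ \<phi> sub])
    have "tiling_image (inv_into UNIV \<phi> \<circ> \<psi>) T = T"
      by (simp add: tiling_image_comp tiling_image_inv[OF \<phi>] flip: eq)
    then have "inv_into UNIV \<phi> \<circ> \<psi> \<in> tiling_aut T"
      using Isom_comp[OF Isom_inv[OF \<phi>] \<psi>] by (simp add: tiling_aut_def)
    moreover have "\<psi> = \<phi> \<circ> (inv_into UNIV \<phi> \<circ> \<psi>)"
      using Isom_inv_comp(2)[OF \<phi>] by (simp flip: comp_assoc)
    ultimately show "\<psi> \<in> \<phi> <#\<^bsub>isom_group\<^esub> tiling_aut T"
      unfolding coset by blast
  qed
  show "tiling_image \<phi> T = tiling_image \<psi> T"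
    if eq: "\<phi> <#\<^bsub>isom_group\<^esub> tiling_aut T = \<psi> <#\<^bsub>isom_group\<^esub> tiling_aut T"
  proof -
    have "id \<in> tiling_aut T"
      by (simp add: tiling_aut_def Isom_id tiling_image_id)
    then have "\<psi> \<in> \<psi> <#\<^bsub>isom_group\<^esub> tiling_aut T"
      by (auto intro!: exI[of _ id] simp: coset)
    then have "\<psi> \<in> \<phi> <#\<^bsub>isom_group\<^esub> tiling_aut T"
      using eq by simp
    then obtain \<gamma> where "\<gamma> \<in> tiling_aut T" "\<psi> = \<phi> \<circ> \<gamma>"
      by (auto simp: coset)
    then show ?thesis
      by (simp add: tiling_image_comp tiling_aut_def)
  qed
qed

theorem proposition4p2:
  fixes ori :: "'a::euclidean_space" and T :: "'a set set"
  assumes "crystallographic_tiling ori T"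
  shows "\<exists>h. homeomorphic_map (hull_space ori T) (coset_space ori (tiling_aut T)) h \<and>
    (\<forall>\<phi>\<in>Isom. \<forall>S\<in>tiling_hull ori T.
       tiling_image \<phi> S \<in> tiling_hull ori T \<and>
       h (tiling_image \<phi> S) = \<phi> <#\<^bsub>isom_group\<^esub> h S)"
proof -
  interpret I: Metric_space Isom "isom_dist ori" by (rule Metric_space_isom_dist)
  interpret M: Metric_space "{T. simple_tiling T}" "tiling_dist ori"
    by (rule Metric_space_tiling_dist)
  interpret G: group isom_group by (rule group_isom_group)
  define \<Gamma> where "\<Gamma> = tiling_aut T"
  define q where "q = (\<lambda>\<phi>. \<phi> <#\<^bsub>isom_group\<^esub> \<Gamma>)"
  have T: "simple_tiling T" and sub: "subgroup \<Gamma> isom_group"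
    and compact: "compact_space (coset_space ori \<Gamma>)"
    using assms by (auto simp: crystallographic_tiling_def crystallographic_group_def \<Gamma>_def)
  have fibres: "tiling_image \<phi> T = tiling_image \<psi> T \<longleftrightarrow> q \<phi> = q \<psi>"
    if "\<phi> \<in> Isom" "\<psi> \<in> Isom" for \<phi> \<psi>
    using tiling_image_eq_iff_coset_eq[of T] sub that by (simp add: q_def \<Gamma>_def)
  have quot: "quotient_map (isom_topology ori) (coset_space ori \<Gamma>) q"
    unfolding coset_space_def q_def by (rule quotient_map_quotient_topology)
  have topI: "topspace (isom_topology ori) = Isom"
    by (simp add: isom_topology_def)
  obtain k where cont: "continuous_map (coset_space ori \<Gamma>) (tiling_topology ori) k"
    and img: "k ` topspace (coset_space ori \<Gamma>) = (\<lambda>\<phi>. tiling_image \<phi> T) ` Isom"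
    and kq: "\<And>\<phi>. \<phi> \<in> Isom \<Longrightarrow> k (q \<phi>) = tiling_image \<phi> T"
    using quotient_map_lift_exists[OF quot continuous_map_orbit[OF T]] fibres
    unfolding topI by metis
  have cosets: "topspace (coset_space ori \<Gamma>) = q ` Isom"
    using quotient_imp_surjective_map[OF quot] topI by simp
  have Haus: "Hausdorff_space (tiling_topology ori)"
    unfolding tiling_topology_def by (rule M.Hausdorff_space_mtopology)
  have "compactin (tiling_topology ori) ((\<lambda>\<phi>. tiling_image \<phi> T) ` Isom)"
    using image_compactin[OF _ cont] compact img unfolding compact_space_def by metis
  then have "closedin (tiling_topology ori) ((\<lambda>\<phi>. tiling_image \<phi> T) ` Isom)"
    by (rule compactin_imp_closedin[OF Haus])
  then have hull: "tiling_hull ori T = (\<lambda>\<phi>. tiling_image \<phi> T) ` Isom"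
    unfolding tiling_hull_def Setcompr_eq_image by (simp add: closure_of_closedin)
  have top_hull: "topspace (hull_space ori T) = (\<lambda>\<phi>. tiling_image \<phi> T) ` Isom"
    unfolding hull_space_def hull topspace_subtopology
    using simple_tiling_tiling_image[OF _ T] by (auto simp: tiling_topology_def)
  have "homeomorphic_map (coset_space ori \<Gamma>) (hull_space ori T) k"
  proof (rule continuous_imp_homeomorphic_map[OF _ compact])
    show "continuous_map (coset_space ori \<Gamma>) (hull_space ori T) k"
      unfolding hull_space_def hull continuous_map_in_subtopology using cont img by auto
    show "Hausdorff_space (hull_space ori T)"
      unfolding hull_space_def using Haus by (rule Hausdorff_space_subtopology)
    show "k ` topspace (coset_space ori \<Gamma>) = topspace (hull_space ori T)"
      using img top_hull by simp
    show "inj_on k (topspace (coset_space ori \<Gamma>))"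
      unfolding cosets using kq fibres by (auto simp: inj_on_def)
  qed
  then obtain h where h: "homeomorphic_maps (coset_space ori \<Gamma>) (hull_space ori T) k h"
    using homeomorphic_map_maps by blast
  have h_orbit: "h (tiling_image \<phi> T) = q \<phi>" if "\<phi> \<in> Isom" for \<phi>
  proof -
    have "h (k (q \<phi>)) = q \<phi>"
      using h that unfolding homeomorphic_maps_def cosets by blast
    then show ?thesis using kq[OF that] by simp
  qed
  have "homeomorphic_map (hull_space ori T) (coset_space ori \<Gamma>) h"
    using h homeomorphic_map_maps homeomorphic_maps_sym by blast
  moreover have "tiling_image \<phi> S \<in> tiling_hull ori T \<and>
      h (tiling_image \<phi> S) = \<phi> <#\<^bsub>isom_group\<^esub> h S"
    if \<phi>: "\<phi> \<in> Isom" and S: "S \<in> tiling_hull ori T" for \<phi> S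
  proof -
    obtain \<psi> where \<psi>: "\<psi> \<in> Isom" "S = tiling_image \<psi> T"
      using S hull by blast
    have eq: "tiling_image \<phi> S = tiling_image (\<phi> \<circ> \<psi>) T"
      by (simp add: \<psi>(2) tiling_image_comp)
    have "q (\<phi> \<circ> \<psi>) = \<phi> <#\<^bsub>isom_group\<^esub> q \<psi>"
      using G.lcos_m_assoc[OF subgroup.subset[OF sub] \<phi> \<psi>(1)] by (simp add: q_def isom_group_def)
    then show ?thesis
      using h_orbit[OF Isom_comp[OF \<phi> \<psi>(1)]] h_orbit[OF \<psi>(1)] Isom_comp[OF \<phi> \<psi>(1)]
      unfolding eq hull unfolding \<psi>(2) by auto
  qed
  ultimately show ?thesis
    unfolding \<Gamma>_def by blast
qed

end
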